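(* Let $j,k$ be non-negative integers. Then there exists a constant $c_{j,k}\in(0,1)$ such that for all sufficiently large $n$ (depending on $j$ and $k$), at least $c_{j,k}\cdot 2^{n+1}$ of the subsets $A$ of $\{0,1,2,\dots,n\}$ satisfy $|A+A|=(2n+1)-j$ and $|A-A|=(2n+1)-2k$.
   Context: For $A\subseteq\mathbb{Z}$, $A+A=\{a_1+a_2 : a_1,a_2\in A\}$ and $A-A=\{a_1-a_2 : a_1,a_2\in A\}$. *)

theory Defs
  imports Complex_Main "HOL-Library.Set_Algebras"
begin

(* The sumset A + B is the one of Set_Algebras. On sets "-" denotes set-theoretic difference,
   so the difference set {a - b} needs a name of its own. *)
definition diffset :: "'a::minus set \<Rightarrow> 'a set \<Rightarrow> 'a set" where
  "diffset A B = {a - b |a b. a \<in> A \<and> b \<in> B}"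

end

theory Submission
  imports Defs "HOL-Library.Disjoint_Sets"
begin

text \<open>
  The gaps of \<open>A + A\<close> and \<open>A - A\<close> are prescribed by the two ends of \<open>A\<close>, whereas a random
  middle part produces every other sum and difference with probability bounded away from \<open>0\<close>.
  If \<open>A\<close> looks like \<open>L\<close> near \<open>0\<close> and like \<open>n - U\<close> near \<open>n\<close>, for cofinite \<open>L\<close> and \<open>U\<close>, then the sums missing near \<open>0\<close> and
  near \<open>2n\<close> are governed by the gaps of \<open>L + L\<close> and \<open>U + U\<close>, and the differences missing near
  \<open>\<plusminus>n\<close> by those of \<open>L + U\<close>. A sum or difference at distance \<open>e\<close> from the extreme values has about
  \<open>e / 2\<close> disjoint representations, so it is missed with probability at most a constant times
  \<open>(3/4) ^ (e / 2)\<close>. Fixing the two ends on a length \<open>N\<close> that makes the tail of this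
  series small, a union bound leaves at least half of all middle parts.

  The fringes come from residues modulo \<open>9\<close>: \<open>R = {0,1,2,5}\<close> and \<open>R' = {0,1,3,4}\<close> are such that
  \<open>R + R\<close> misses exactly the class of \<open>8\<close>, \<open>R + R'\<close> exactly that of \<open>7\<close>, and \<open>R' + R'\<close> no class.
  Adding \<open>8\<close> to \<open>R\<close> fills the gap of \<open>R + R\<close> but not that of \<open>R + R'\<close>. So \<open>L\<close> keeps
  to \<open>R\<close> on \<open>j\<close> periods, \<open>U\<close> keeps to \<open>R'\<close> on \<open>k\<close> periods, and the missing elements
  are counted by periods.
\<close>

section \<open>Counting sets that contain no member of a disjoint family\<close>

text \<open>For a uniformly random subset of \<open>X\<close> the events belonging to disjoint
  \<open>P i\<close> are independent, and a set of at most two elements fails to be included with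
  probability at most 3/4. The induction splits \<open>B\<close> into its parts outside and inside
  \<open>P i\<close>.\<close>

lemma card_avoiding_disjoint_family:
  fixes P :: "'i \<Rightarrow> 'a set"
  assumes "finite I" "finite X" "disjoint_family_on P I"
    and "\<And>i. i \<in> I \<Longrightarrow> P i \<subseteq> X" "\<And>i. i \<in> I \<Longrightarrow> card (P i) \<le> 2"
  shows "real (card {B. B \<subseteq> X \<and> (\<forall>i\<in>I. \<not> P i \<subseteq> B)}) \<le> (3/4) ^ card I * 2 ^ card X"
  using assms
proof (induction I arbitrary: X rule: finite_induct)
  case empty
  then show ?case by (simp add: card_Pow flip: Pow_def)
next
  case (insert i I)
  let ?S = "{B. B \<subseteq> X \<and> (\<forall>i\<in>insert i I. \<not> P i \<subseteq> B)}"
  let ?T = "{B. B \<subseteq> X - P i \<and> (\<forall>i\<in>I. \<not> P i \<subseteq> B)}"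
  have PX: "P i \<subseteq> X" and fin: "finite (P i)"
    using insert.prems by (auto intro: finite_subset)
  have disj: "P i' \<inter> P i = {}" if "i' \<in> I" for i'
    using insert.prems(2) insert.hyps(2) that by (metis disjoint_family_onD insertCI)
  have IH: "real (card ?T) \<le> (3/4) ^ card I * 2 ^ card (X - P i)"
  proof (rule insert.IH)
    show "disjoint_family_on P I"
      using insert.prems(2) by (auto simp: disjoint_family_on_def)
    show "P i' \<subseteq> X - P i" if "i' \<in> I" for i'
      using insert.prems(3)[of i'] disj[OF that] that by blast
  qed (use insert.prems in auto)
  let ?f = "\<lambda>B. (B - P i, B \<inter> P i)"
  have "inj_on ?f ?S" by (auto simp: inj_on_def)
  moreover have "?f ` ?S \<subseteq> ?T \<times> (Pow (P i) - {P i})" using disj by blast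
  moreover have "finite (?T \<times> (Pow (P i) - {P i}))"
    using insert.prems(1) fin by (auto intro!: finite_subset[of ?T "Pow X"])
  ultimately have "card ?S \<le> card (?T \<times> (Pow (P i) - {P i}))"
    by (rule card_inj_on_le)
  also have "\<dots> = card ?T * (2 ^ card (P i) - 1)"
    using fin by (simp add: card_cartesian_product card_Diff_singleton card_Pow)
  finally have "real (card ?S) \<le> real (card ?T) * real (2 ^ card (P i) - 1)"
    unfolding of_nat_mult[symmetric] of_nat_le_iff .
  also have "real (2 ^ card (P i) - 1) \<le> 3/4 * 2 ^ card (P i)"
  proof -
    have "card (P i) \<in> {0,1,2}" using insert.prems(4)[of i] by auto
    then show ?thesis by auto
  qed
  also have "real (card ?T) * (3/4 * 2 ^ card (P i))
      \<le> ((3/4) ^ card I * 2 ^ card (X - P i)) * (3/4 * 2 ^ card (P i))"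
    by (rule mult_right_mono[OF IH]) simp
  also have "\<dots> = (3/4) ^ card (insert i I) * 2 ^ (card (X - P i) + card (P i))"
    using insert.hyps by (simp add: power_add)
  also have "card (X - P i) + card (P i) = card X"
    using PX fin insert.prems(1) by (simp add: card_Diff_subset card_mono)
  finally show ?case by (simp add: mult_left_mono)
qed

lemma card_extensions_avoiding_disjoint_family:
  fixes P :: "'i \<Rightarrow> 'a set"
  assumes "finite I" "finite X" "finite H" "disjoint_family_on P I"
    and sub: "\<And>i. i \<in> I \<Longrightarrow> P i \<subseteq> F \<union> X \<union> H"
    and two: "\<And>i. i \<in> I \<Longrightarrow> finite (P i) \<and> card (P i) \<le> 2"
  shows "real (card {B. B \<subseteq> X \<and> (\<forall>i\<in>I. \<not> P i \<subseteq> F \<union> B)})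
    \<le> (3/4) ^ (card I - card H) * 2 ^ card X"
proof -
  define J where "J = {i\<in>I. P i \<inter> H = {}}"
  have J: "J \<subseteq> I" "finite J" using assms(1) by (auto simp: J_def)
  \<comment> \<open>One point of \<open>H\<close> is chosen per discarded index; disjointness makes
    the choice injective, so at most \<open>card H\<close> indices are lost.\<close>
  define h where "h i = (SOME x. x \<in> P i \<inter> H)" for i
  have h: "h i \<in> P i \<inter> H" if "i \<in> I - J" for i
  proof -
    have "\<exists>x. x \<in> P i \<inter> H" using that unfolding J_def by blast
    then show ?thesis unfolding h_def by (rule someI_ex)
  qed
  have "inj_on h (I - J)"
  proof (rule inj_onI)
    fix i i' assume *: "i \<in> I - J" "i' \<in> I - J" "h i = h i'"
    then have "h i \<in> P i \<inter> P i'" using h[of i] h[of i'] by auto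
    then show "i = i'" using * assms(4) unfolding disjoint_family_on_def by blast
  qed
  then have "card (I - J) \<le> card H"
    using h assms(3) by (intro card_inj_on_le[of h]) auto
  then have cJ: "card I - card H \<le> card J"
    using J by (simp add: card_Diff_subset)
  let ?Q = "\<lambda>i. P i \<inter> X"
  have "{B. B \<subseteq> X \<and> (\<forall>i\<in>I. \<not> P i \<subseteq> F \<union> B)} \<subseteq> {B. B \<subseteq> X \<and> (\<forall>i\<in>J. \<not> ?Q i \<subseteq> B)}"
    using sub unfolding J_def by blast
  moreover have "finite {B. B \<subseteq> X \<and> (\<forall>i\<in>J. \<not> ?Q i \<subseteq> B)}"
    using assms(2) by (auto intro: finite_subset[of _ "Pow X"])
  ultimately have "real (card {B. B \<subseteq> X \<and> (\<forall>i\<in>I. \<not> P i \<subseteq> F \<union> B)})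
      \<le> real (card {B. B \<subseteq> X \<and> (\<forall>i\<in>J. \<not> ?Q i \<subseteq> B)})"
    by (simp add: card_mono)
  also have "\<dots> \<le> (3/4) ^ card J * 2 ^ card X"
  proof (rule card_avoiding_disjoint_family)
    show "disjoint_family_on ?Q J"
      using assms(4) J unfolding disjoint_family_on_def by blast
    show "card (?Q i) \<le> 2" if "i \<in> J" for i
      using two[of i] that J card_mono[of "P i" "?Q i"] by force
  qed (use J assms in auto)
  also have "\<dots> \<le> (3/4) ^ (card I - card H) * 2 ^ card X"
    using cJ by (intro mult_right_mono power_decreasing) auto
  finally show ?thesis .
qed

text \<open>The map \<open>g\<close> enumerates the integers in the even-numbered blocks of length \<open>d\<close>, so that
  \<open>g t + d\<close> lies in an odd-numbered one.\<close>

lemma disjoint_translate_pairs: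
  fixes d :: int
  assumes "0 \<le> d" "0 \<le> t" "0 \<le> t'" "t \<noteq> t'"
  defines "g \<equiv> \<lambda>t. t + t div d * d"
  shows "{g t, g t + d} \<inter> {g t', g t' + d} = {}"
proof (cases "d = 0")
  \<comment> \<open>For \<open>d = 0\<close> the map \<open>g\<close> is the identity and the pairs
    collapse to singletons.\<close>
  case True
  then show ?thesis using assms by auto
next
  case False
  have g: "g t = 2 * (t div d) * d + t mod d" for t
    unfolding g_def using div_mult_mod_eq[of t d] by (simp add: algebra_simps)
  have quot: "g t div d = 2 * (t div d)" "(g t + d) div d = 2 * (t div d) + 1"
    and rem: "g t mod d = t mod d" "(g t + d) mod d = t mod d" for t
    using False assms(1) by (simp_all add: g div_mult_self3)
  have eq: "t div d = t' div d \<Longrightarrow> t mod d = t' mod d \<Longrightarrow> t = t'"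
    by (metis div_mult_mod_eq)
  show ?thesis
  proof (rule ccontr)
    assume "\<not> ?thesis"
    then consider "g t = g t'" | "g t = g t' + d" | "g t + d = g t'" | "g t + d = g t' + d"
      by auto
    then show False
    proof cases
      case 2
      then have "even (2 * (t' div d) + 1)" using quot by (metis dvd_triv_left)
      then show False by simp
    next
      case 3
      then have "even (2 * (t div d) + 1)" using quot by (metis dvd_triv_left)
      then show False by simp
    qed (use eq quot[of t] quot[of t'] rem[of t] rem[of t'] assms(4) in auto)
  qed
qed

text \<open>Comparison with ratio 9/10, as 3/4 is below its square 81/100. The factor 10/9 pays for
  the rounding in \<open>e div 2\<close>; the truncated subtraction affects only the finitely many
  \<open>e < 2 * h\<close>.\<close>

lemma summable_three_quarters_half: "summable (\<lambda>e. (3/4::real) ^ (e div 2 - h))"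
proof (rule summable_comparison_test)
  show "\<exists>N. \<forall>e\<ge>N. norm ((3/4::real) ^ (e div 2 - h)) \<le> (4/3) ^ h * (10/9) * (9/10) ^ e"
  proof (intro exI allI impI)
    fix e :: nat assume e: "2 * h \<le> e"
    then have "(3/4::real) ^ (e div 2 - h) = (4/3) ^ h * (3/4) ^ (e div 2)"
      by (simp add: power_diff power_divide)
    also have "(3/4::real) ^ (e div 2) \<le> ((9/10)^2) ^ (e div 2)"
      by (intro power_mono) (auto simp: power2_eq_square)
    also have "\<dots> = (9/10) ^ (2 * (e div 2))" by (simp only: power_mult)
    also have "\<dots> = (10/9) * (9/10) ^ Suc (2 * (e div 2))" by simp
    also have "\<dots> \<le> (10/9) * (9/10) ^ e"
      by (intro mult_left_mono power_decreasing) auto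
    finally show "norm ((3/4::real) ^ (e div 2 - h)) \<le> (4/3) ^ h * (10/9) * (9/10) ^ e"
      by (simp add: mult_left_mono mult.assoc)
  qed
  show "summable (\<lambda>e. (4/3) ^ h * (10/9) * (9/10::real) ^ e)"
    by (intro summable_mult summable_geometric) simp
qed

section \<open>Sets with prescribed fringes\<close>

definition gaps :: "int set \<Rightarrow> int set" where
  "gaps S = {0..} - S"

locale fringes =
  fixes L U :: "int set" and s :: nat
  assumes L_nonneg: "L \<subseteq> {0..}" and U_nonneg: "U \<subseteq> {0..}"
    and L_cofinite: "{int s..} \<subseteq> L" and U_cofinite: "{int s..} \<subseteq> U"
begin

text \<open>The largest set with the prescribed ends; \<open>U\<close> is read as distances from
  \<open>n\<close>. The sets to be counted are \<open>fringe N n \<union> B\<close> with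
  \<open>B\<close> inside \<open>middle N n\<close>.\<close>

definition envelope :: "nat \<Rightarrow> int set" where
  "envelope n = {x \<in> {0..int n}. x \<in> L \<and> int n - x \<in> U}"

definition middle :: "nat \<Rightarrow> nat \<Rightarrow> int set" where
  "middle N n = {int N..int n - int N}"

definition fringe :: "nat \<Rightarrow> nat \<Rightarrow> int set" where
  "fringe N n = envelope n - middle N n"

section \<open>Probability that a sum or difference is missed\<close>

lemma finite_middle: "finite (middle N n)"
  by (simp add: middle_def)

lemma middle_subset_envelope: "s \<le> N \<Longrightarrow> middle N n \<subseteq> envelope n"
  using L_cofinite U_cofinite by (force simp: middle_def envelope_def)

text \<open>The holes of the envelope lie within distance \<open>s\<close> of an end, so at most
  \<open>2 * s\<close> of the \<open>e div 2 + 1\<close> disjoint representations are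
  spoiled.\<close>

lemma card_missing_representation:
  fixes P :: "nat \<Rightarrow> int set"
  assumes "s \<le> N" "disjoint_family_on P {..e div 2}"
    and "\<And>t. t \<le> e div 2 \<Longrightarrow> P t \<subseteq> {0..int n}"
    and "\<And>t. t \<le> e div 2 \<Longrightarrow> card (P t) \<le> 2"
  shows "real (card {B. B \<subseteq> middle N n \<and> (\<forall>t\<le>e div 2. \<not> P t \<subseteq> fringe N n \<union> B)})
    \<le> (3/4) ^ (e div 2 - 2 * s) * 2 ^ card (middle N n)"
proof -
  define H where "H = {0..int n} - envelope n"
  have "H \<subseteq> {0..<int s} \<union> {int n - int s<..int n}"
  proof
    fix x assume "x \<in> H"
    moreover have "int s \<le> x \<Longrightarrow> x \<in> L" "int s \<le> int n - x \<Longrightarrow> int n - x \<in> U"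
      using L_cofinite U_cofinite by auto
    ultimately show "x \<in> {0..<int s} \<union> {int n - int s<..int n}"
      by (cases "int s \<le> x"; cases "int s \<le> int n - x") (auto simp: H_def envelope_def)
  qed
  then have "card H \<le> card ({0..<int s} \<union> {int n - int s<..int n})"
    by (intro card_mono) auto
  also have "\<dots> \<le> 2 * s"
    by (rule order_trans[OF card_Un_le]) simp
  finally have H: "card H \<le> 2 * s" .
  have "real (card {B. B \<subseteq> middle N n \<and> (\<forall>t\<in>{..e div 2}. \<not> P t \<subseteq> fringe N n \<union> B)})
    \<le> (3/4) ^ (card {..e div 2} - card H) * 2 ^ card (middle N n)"
  proof (rule card_extensions_avoiding_disjoint_family)
    show "P t \<subseteq> fringe N n \<union> middle N n \<union> H" if "t \<in> {..e div 2}" for t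
      using assms(3)[of t] that by (auto simp: fringe_def H_def)
    show "finite (P t) \<and> card (P t) \<le> 2" if "t \<in> {..e div 2}" for t
      using assms(3,4)[of t] that by (auto intro: finite_subset)
  qed (use assms(2) finite_middle in \<open>auto simp: H_def\<close>)
  also have "\<dots> \<le> (3/4) ^ (e div 2 - 2 * s) * 2 ^ card (middle N n)"
    using H by (intro mult_right_mono power_decreasing) auto
  finally show ?thesis by (simp only: Ball_def atMost_iff)
qed

text \<open>Here \<open>e\<close> is the distance from the extreme values 0 and \<open>2 * n\<close>
  of the sums and \<open>n\<close> of the differences. Negative differences follow by
  symmetry.\<close>

definition missing_at :: "nat \<Rightarrow> nat \<Rightarrow> int set \<Rightarrow> bool" where
  "missing_at n e A \<longleftrightarrow>
    int e \<notin> A + A \<or> 2 * int n - int e \<notin> A + A \<or> int n - int e \<notin> diffset A A"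

text \<open>Each of the three events has its own disjoint family of representations:
  \<open>P1\<close> for the low sum, its reflection \<open>P2\<close> for the high sum, and
  translate pairs \<open>P3\<close> for the difference.\<close>

lemma card_missing_at:
  assumes "s \<le> N" "e \<le> n"
  shows "real (card {B. B \<subseteq> middle N n \<and> missing_at n e (fringe N n \<union> B)})
    \<le> 3 * (3/4) ^ (e div 2 - 2 * s) * 2 ^ card (middle N n)"
proof -
  define g where "g t = t + t div (int n - int e) * (int n - int e)" for t
  define P1 where "P1 t = {int t, int e - int t}" for t
  define P2 where "P2 t = {int n - int t, int n - (int e - int t)}" for t
  define P3 where "P3 t = {g (int t), g (int t) + (int n - int e)}" for t
  let ?M = "middle N n" and ?F = "fringe N n"
  let ?E = "\<lambda>P. {B. B \<subseteq> ?M \<and> (\<forall>t\<le>e div 2. \<not> P t \<subseteq> ?F \<union> B)}"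
  let ?b = "(3/4) ^ (e div 2 - 2 * s) * 2 ^ card ?M :: real"
  \<comment> \<open>Skipping the odd blocks at most doubles \<open>t\<close>, so
    \<open>g (int t)\<close> is at most \<open>e\<close>.\<close>
  have g: "0 \<le> g (int t)" "g (int t) + (int n - int e) \<le> int n" if "t \<le> e div 2" for t
  proof -
    have "0 \<le> int t div (int n - int e) * (int n - int e)"
      using assms by (cases "int n - int e = 0") (auto simp: pos_imp_zdiv_nonneg_iff)
    moreover have "0 \<le> int t mod (int n - int e)"
      using assms by (cases "e = n") auto
    then have "int t div (int n - int e) * (int n - int e) \<le> int t"
      using div_mult_mod_eq[of "int t" "int n - int e"] by linarith
    ultimately show "0 \<le> g (int t)" "g (int t) + (int n - int e) \<le> int n"
      using that by (auto simp: g_def)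
  qed
  have b1: "real (card (?E P1)) \<le> ?b"
    using assms by (intro card_missing_representation)
      (auto simp: P1_def disjoint_family_on_def card_insert_if)
  have b2: "real (card (?E P2)) \<le> ?b"
    using assms by (intro card_missing_representation)
      (auto simp: P2_def disjoint_family_on_def card_insert_if)
  have b3: "real (card (?E P3)) \<le> ?b"
  proof (intro card_missing_representation)
    show "disjoint_family_on P3 {..e div 2}"
      unfolding disjoint_family_on_def P3_def g_def
      by (intro ballI impI disjoint_translate_pairs) (use assms in auto)
    show "P3 t \<subseteq> {0..int n}" if "t \<le> e div 2" for t
      using g[OF that] assms(2) unfolding P3_def by auto
  qed (use assms in \<open>auto simp: P3_def card_insert_if\<close>)
  have sum1: "int e \<in> A + A" if "P1 t \<subseteq> A" for t A
    using that set_plus_intro[of "int t" A "int e - int t" A] by (simp add: P1_def)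
  have sum2: "2 * int n - int e \<in> A + A" if "P2 t \<subseteq> A" for t A
    using that set_plus_intro[of "int n - int t" A "int n - (int e - int t)" A]
    by (simp add: P2_def)
  have diff3: "int n - int e \<in> diffset A A" if "P3 t \<subseteq> A" for t A
  proof -
    have "g (int t) + (int n - int e) - g (int t) \<in> diffset A A"
      using that unfolding diffset_def P3_def by blast
    then show ?thesis by simp
  qed
  have "{B. B \<subseteq> ?M \<and> missing_at n e (?F \<union> B)} \<subseteq> ?E P1 \<union> ?E P2 \<union> ?E P3"
    using sum1 sum2 diff3 unfolding missing_at_def by blast
  moreover have fin: "finite (?E P)" for P
    using finite_middle by (auto intro: finite_subset[of _ "Pow ?M"])
  ultimately have "card {B. B \<subseteq> ?M \<and> missing_at n e (?F \<union> B)}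
      \<le> card (?E P1 \<union> ?E P2 \<union> ?E P3)"
    by (intro card_mono finite_UnI) auto
  also have "\<dots> \<le> card (?E P1) + card (?E P2) + card (?E P3)"
    by (rule order_trans[OF card_Un_le add_right_mono[OF card_Un_le]])
  finally show ?thesis using b1 b2 b3 by linarith
qed

text \<open>Union bound: three events per \<open>e\<close> turn a tail of 1/6 into a failure
  probability of at most 1/2.\<close>

lemma card_not_missing:
  assumes "s \<le> N" "(\<Sum>e=N..n. (3/4::real) ^ (e div 2 - 2 * s)) \<le> 1/6"
  shows "2 ^ card (middle N n) / 2
    \<le> real (card {B. B \<subseteq> middle N n \<and> (\<forall>e\<in>{N..n}. \<not> missing_at n e (fringe N n \<union> B))})"
    (is "_ \<le> real (card ?G)")
proof -
  let ?M = "middle N n"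
  let ?E = "\<lambda>e. {B. B \<subseteq> ?M \<and> missing_at n e (fringe N n \<union> B)}"
  have fin: "finite ?G" "finite (?E e)" for e
    using finite_middle by (auto intro: finite_subset[of _ "Pow ?M"])
  have "2 ^ card ?M = card (Pow ?M)" using finite_middle by (simp add: card_Pow)
  also have "\<dots> \<le> card (?G \<union> (\<Union>e\<in>{N..n}. ?E e))"
    using fin by (intro card_mono) auto
  also have "\<dots> \<le> card ?G + (\<Sum>e=N..n. card (?E e))"
    by (rule order_trans[OF card_Un_le add_left_mono[OF card_UN_le]]) simp
  finally have "real (2 ^ card ?M) \<le> real (card ?G + (\<Sum>e=N..n. card (?E e)))"
    by (simp only: of_nat_le_iff)
  then have "2 ^ card ?M \<le> real (card ?G) + (\<Sum>e=N..n. real (card (?E e)))"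
    by simp
  also have "(\<Sum>e=N..n. real (card (?E e)))
      \<le> (\<Sum>e=N..n. 3 * (3/4) ^ (e div 2 - 2 * s) * 2 ^ card ?M)"
    using assms(1) by (intro sum_mono card_missing_at) auto
  also have "\<dots> = 3 * 2 ^ card ?M * (\<Sum>e=N..n. (3/4::real) ^ (e div 2 - 2 * s))"
    by (simp add: sum_distrib_left mult_ac)
  also have "\<dots> \<le> 3 * 2 ^ card ?M * (1/6)"
    by (rule mult_left_mono[OF assms(2)]) simp
  finally show ?thesis by simp
qed

section \<open>Exact sumset and difference set when no central value is missing\<close>

text \<open>Near either end the summands are nonnegative and smaller than \<open>N\<close> (after
  reflection at the top), hence lie in the forced fringe; \<open>full\<close> supplies the remaining
  sums.\<close>

lemma sumset_eq:
  assumes "s \<le> N" "2 * N \<le> n" "fringe N n \<subseteq> A" "A \<subseteq> envelope n"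
    and full: "\<And>e. e \<in> {N..n} \<Longrightarrow> \<not> missing_at n e A"
  shows "A + A = {0..2 * int n} - (gaps (L + L) \<union> (\<lambda>x. 2 * int n - x) ` gaps (U + U))"
    (is "_ = ?R")
proof
  show "A + A \<subseteq> ?R"
  proof
    fix x assume "x \<in> A + A"
    then obtain a b where x: "x = a + b" "a \<in> A" "b \<in> A" by (auto elim: set_plus_elim)
    then have ab: "a \<in> envelope n" "b \<in> envelope n" using assms(4) by auto
    have "x \<in> L + L" using x ab by (auto simp: envelope_def)
    moreover have "(int n - a) + (int n - b) \<in> U + U"
      using ab by (intro set_plus_intro) (auto simp: envelope_def)
    moreover have "(int n - a) + (int n - b) = 2 * int n - x" using x by simp
    ultimately have "x \<in> L + L" "2 * int n - x \<in> U + U" by simp_all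
    then show "x \<in> ?R" using ab x by (auto simp: envelope_def gaps_def)
  qed
  show "?R \<subseteq> A + A"
  proof
    fix x assume x: "x \<in> ?R"
    then have "2 * int n - x \<notin> gaps (U + U)"
      using image_eqI[of x "\<lambda>x. 2 * int n - x" "2 * int n - x"] by auto
    then have xL: "x \<in> L + L" and xU: "2 * int n - x \<in> U + U"
      using x by (auto simp: gaps_def)
    consider "x < int N" | "2 * int n - int N < x" | "int N \<le> x" "x \<le> int n"
      | "int n \<le> x" "x \<le> 2 * int n - int N" by linarith
    then show "x \<in> A + A"
    proof cases
      case 1
      obtain a b where ab: "x = a + b" "a \<in> L" "b \<in> L" using xL by (auto elim: set_plus_elim)
      \<comment> \<open>Since \<open>2 * N \<le> n\<close>, the point \<open>int n - c\<close> is
        beyond \<open>s\<close>, so \<open>U\<close> imposes no condition on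
        \<open>c\<close>.\<close>
      have "c \<in> A" if "c \<in> L" "c < int N" for c
        using that assms(1-3) L_nonneg U_cofinite
        by (force simp: fringe_def envelope_def middle_def)
      moreover have "0 \<le> a" "0 \<le> b" using ab L_nonneg by auto
      ultimately have "a \<in> A" "b \<in> A" using ab 1 by auto
      then show ?thesis using ab by auto
    next
      case 2
      obtain a b where ab: "2 * int n - x = a + b" "a \<in> U" "b \<in> U"
        using xU by (auto elim: set_plus_elim)
      have "int n - c \<in> A" if "c \<in> U" "c < int N" for c
        using that assms(1-3) U_nonneg L_cofinite
        by (force simp: fringe_def envelope_def middle_def)
      moreover have "0 \<le> a" "0 \<le> b" using ab U_nonneg by auto
      ultimately have "int n - a \<in> A" "int n - b \<in> A" using ab 2 by auto
      moreover have "x = (int n - a) + (int n - b)" using ab by simp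
      ultimately show ?thesis by (metis set_plus_intro)
    next
      case 3
      then show ?thesis using full[of "nat x"] by (simp add: missing_at_def le_nat_iff)
    next
      case 4
      then show ?thesis using full[of "nat (2 * int n - x)"]
        by (simp add: missing_at_def le_nat_iff)
    qed
  qed
qed

text \<open>The distance of \<open>a - b\<close> from \<open>n\<close> is
  \<open>b + (int n - a)\<close>, a lower element plus a reflected upper one; this is why the mixed
  sumset \<open>L + U\<close> appears, and symmetry gives both signs.\<close>

lemma diffset_eq:
  assumes "s \<le> N" "2 * N \<le> n" "fringe N n \<subseteq> A" "A \<subseteq> envelope n"
    and full: "\<And>e. e \<in> {N..n} \<Longrightarrow> \<not> missing_at n e A"
  shows "diffset A A = {- int n..int n} -
    ((\<lambda>e. int n - e) ` gaps (L + U) \<union> (\<lambda>e. e - int n) ` gaps (L + U))"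
    (is "_ = ?R")
proof
  have gap: "int n - (a - b) \<in> L + U" if "a \<in> A" "b \<in> A" for a b
  proof -
    have "b \<in> L" "int n - a \<in> U" using that assms(4) by (auto simp: envelope_def)
    then have "b + (int n - a) \<in> L + U" by (rule set_plus_intro)
    then show ?thesis by (simp add: algebra_simps)
  qed
  show "diffset A A \<subseteq> ?R"
  proof
    fix x assume "x \<in> diffset A A"
    then obtain a b where x: "x = a - b" "a \<in> A" "b \<in> A" by (auto simp: diffset_def)
    then have "a \<in> {0..int n}" "b \<in> {0..int n}" using assms(4) by (auto simp: envelope_def)
    then show "x \<in> ?R" using gap[of a b] gap[of b a] x by (auto simp: gaps_def algebra_simps)
  qed
  have pos: "d \<in> diffset A A" if d: "0 \<le> d" "d \<le> int n" "int n - d \<in> L + U" for d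
  proof (cases "int n - d < int N")
    case True
    obtain a b where ab: "int n - d = a + b" "a \<in> L" "b \<in> U"
      using d(3) by (rule set_plus_elim)
    have "0 \<le> a" "0 \<le> b" using ab L_nonneg U_nonneg by auto
    then have "a < int N" "b < int N" using ab True by auto
    then have "a \<in> A" "int n - b \<in> A"
      using ab \<open>0 \<le> a\<close> \<open>0 \<le> b\<close> assms(1-3) L_cofinite U_cofinite
      by (force simp: fringe_def envelope_def middle_def)+
    moreover have "d = (int n - b) - a" using ab by simp
    ultimately show ?thesis by (auto simp: diffset_def)
  next
    case False
    then show ?thesis using full[of "nat (int n - d)"] d by (simp add: missing_at_def le_nat_iff)
  qed
  show "?R \<subseteq> diffset A A"
  proof
    fix x assume x: "x \<in> ?R"
    then have "int n - x \<notin> gaps (L + U)" "int n + x \<notin> gaps (L + U)"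
      by (force simp: image_iff)+
    then have "int n - x \<in> L + U" "int n + x \<in> L + U" using x by (auto simp: gaps_def)
    then have "\<bar>x\<bar> \<in> diffset A A" using x by (intro pos) (auto simp: abs_if)
    then show "x \<in> diffset A A"
      by (auto simp: diffset_def abs_if split: if_splits) (metis minus_diff_eq minus_minus)
  qed
qed

lemma gaps_less:
  assumes "S \<subseteq> {0..}" "{int s..} \<subseteq> S" "T \<subseteq> {0..}" "{int s..} \<subseteq> T"
  shows "gaps (S + T) \<subseteq> {0..<2 * int s}"
proof
  fix x assume x: "x \<in> gaps (S + T)"
  have "x \<in> S + T" if "2 * int s \<le> x"
  proof -
    have "int s \<in> S" "x - int s \<in> T" using that assms(2,4) by auto
    then have "int s + (x - int s) \<in> S + T" by (rule set_plus_intro)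
    then show ?thesis by simp
  qed
  then show "x \<in> {0..<2 * int s}" using x by (force simp: gaps_def)
qed

text \<open>All gaps are below \<open>2 * s\<close>, so those at the two ends of the range cannot
  overlap and their numbers add up.\<close>

lemma card_sumset:
  assumes "2 * s \<le> N" "2 * N \<le> n" "fringe N n \<subseteq> A" "A \<subseteq> envelope n"
    and full: "\<And>e. e \<in> {N..n} \<Longrightarrow> \<not> missing_at n e A"
  shows "int (card (A + A))
    = 2 * int n + 1 - int (card (gaps (L + L)) + card (gaps (U + U)))"
proof -
  let ?g = "\<lambda>x. 2 * int n - x"
  let ?D = "gaps (L + L) \<union> ?g ` gaps (U + U)"
  have sub: "gaps (L + L) \<subseteq> {0..<2 * int s}" "gaps (U + U) \<subseteq> {0..<2 * int s}"
    using gaps_less L_nonneg U_nonneg L_cofinite U_cofinite by auto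
  then have fin: "finite (gaps (L + L))" "finite (gaps (U + U))"
    by (auto intro: finite_subset)
  have "?D \<subseteq> {0..2 * int n}" using sub assms(1,2) by force
  then have "int (card ({0..2 * int n} - ?D)) = int (card {0..2 * int n}) - int (card ?D)"
    using fin by (simp add: card_Diff_subset of_nat_diff card_mono del: card_atLeastAtMost_int)
  moreover have "gaps (L + L) \<inter> ?g ` gaps (U + U) = {}"
    using sub assms(1,2) by force
  then have "card ?D = card (gaps (L + L)) + card (gaps (U + U))"
    using fin by (simp add: card_Un_disjoint card_image inj_on_def)
  ultimately show ?thesis
    using sumset_eq[of N n A] assms by simp
qed

lemma card_diffset:
  assumes "2 * s \<le> N" "2 * N \<le> n" "fringe N n \<subseteq> A" "A \<subseteq> envelope n"
    and full: "\<And>e. e \<in> {N..n} \<Longrightarrow> \<not> missing_at n e A"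
  shows "int (card (diffset A A)) = 2 * int n + 1 - 2 * int (card (gaps (L + U)))"
proof -
  let ?G = "gaps (L + U)"
  let ?D = "(\<lambda>e. int n - e) ` ?G \<union> (\<lambda>e. e - int n) ` ?G"
  have sub: "?G \<subseteq> {0..<2 * int s}"
    using gaps_less L_nonneg U_nonneg L_cofinite U_cofinite by auto
  then have fin: "finite ?G" by (auto intro: finite_subset)
  have "?D \<subseteq> {- int n..int n}" using assms(1,2) by (auto dest!: subsetD[OF sub])
  then have "int (card ({- int n..int n} - ?D)) = int (card {- int n..int n}) - int (card ?D)"
    using fin by (simp add: card_Diff_subset of_nat_diff card_mono del: card_atLeastAtMost_int)
  moreover have "(\<lambda>e. int n - e) ` ?G \<inter> (\<lambda>e. e - int n) ` ?G = {}"
    using assms(1,2) by (auto dest!: subsetD[OF sub])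
  then have "card ?D = 2 * card ?G"
    using fin by (simp add: card_Un_disjoint card_image inj_on_def)
  ultimately show ?thesis
    using diffset_eq[of N n A] assms by simp
qed

text \<open>\<open>N\<close> depends only on \<open>L\<close>, \<open>U\<close> and
  \<open>s\<close>. Fixing both ends costs a factor \<open>2 ^ (2 * N)\<close>, and discarding bad
  middles another factor 2.\<close>

theorem positive_proportion:
  "\<exists>c::real. 0 < c \<and> c < 1 \<and>
    (\<forall>\<^sub>F n in sequentially.
      c * 2 ^ (n + 1) \<le> real (card {A :: int set. A \<subseteq> {0..int n} \<and>
        int (card (A + A)) = (2 * int n + 1) - int (card (gaps (L + L)) + card (gaps (U + U))) \<and>
        int (card (diffset A A)) = (2 * int n + 1) - 2 * int (card (gaps (L + U)))}))"
proof -
  let ?f = "\<lambda>e. (3/4::real) ^ (e div 2 - 2 * s)"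
  obtain N0 where N0: "norm (sum ?f {m..<n}) < 1/6" if "N0 \<le> m" for m n
    using summable_three_quarters_half[of "2 * s"] unfolding summable_Cauchy
    by (metis zero_less_divide_1_iff zero_less_numeral)
  \<comment> \<open>The first bound makes the tail small, the second keeps the gaps within the fixed
    ends.\<close>
  define N where "N = max N0 (2 * s)"
  have tail: "sum ?f {N..n} \<le> 1/6" for n
    using N0[of N "Suc n"] by (simp add: N_def atLeastLessThanSuc_atLeastAtMost)
  have sN: "2 * s \<le> N" by (simp add: N_def)
  show ?thesis
  proof (intro exI[of _ "1 / 2 ^ (2 * N + 1)"] conjI)
    have "(1::real) < 2 ^ (2 * N + 1)" by (intro one_less_power) auto
    then show "1 / 2 ^ (2 * N + 1) < (1::real)" by (simp add: divide_less_eq)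
    show "\<forall>\<^sub>F n in sequentially.
      1 / 2 ^ (2 * N + 1) * 2 ^ (n + 1) \<le> real (card {A :: int set. A \<subseteq> {0..int n} \<and>
        int (card (A + A)) = (2 * int n + 1) - int (card (gaps (L + L)) + card (gaps (U + U))) \<and>
        int (card (diffset A A)) = (2 * int n + 1) - 2 * int (card (gaps (L + U)))})"
      using eventually_ge_at_top[of "2 * N"]
    proof eventually_elim
      case (elim n)
      let ?F = "fringe N n" and ?M = "middle N n"
      let ?G = "{B. B \<subseteq> ?M \<and> (\<forall>e\<in>{N..n}. \<not> missing_at n e (?F \<union> B))}"
      let ?S = "{A :: int set. A \<subseteq> {0..int n} \<and>
        int (card (A + A)) = (2 * int n + 1) - int (card (gaps (L + L)) + card (gaps (U + U))) \<and>
        int (card (diffset A A)) = (2 * int n + 1) - 2 * int (card (gaps (L + U)))}"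
      have "card ?M = n + 1 - 2 * N" using elim by (simp add: middle_def)
      then have "1 / 2 ^ (2 * N + 1) * 2 ^ (n + 1) = (2 ^ card ?M / 2 :: real)"
        using elim by (simp add: power_diff)
      also have "\<dots> \<le> real (card ?G)"
        using sN tail by (intro card_not_missing) auto
      also have "card ?G \<le> card ?S"
      proof (rule card_inj_on_le)
        show "inj_on (\<lambda>B. ?F \<union> B) ?G"
          by (auto simp: inj_on_def fringe_def)
        show "(\<lambda>B. ?F \<union> B) ` ?G \<subseteq> ?S"
        proof (rule image_subsetI)
          fix B assume B: "B \<in> ?G"
          then have sub: "?F \<union> B \<subseteq> envelope n"
            using middle_subset_envelope[of N n] sN by (auto simp: fringe_def)
          then have "?F \<union> B \<subseteq> {0..int n}" by (auto simp: envelope_def)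
          then show "?F \<union> B \<in> ?S"
            using card_sumset[OF sN elim _ sub] card_diffset[OF sN elim _ sub] B by auto
        qed
        show "finite ?S" by (rule finite_subset[of _ "Pow {0..int n}"]) auto
      qed
      finally show ?case by simp
    qed
  qed simp
qed

end

section \<open>Fringes with prescribed gaps\<close>

text \<open>Class 8 enters after \<open>j\<close> periods. The full tail starts only after
  \<open>j + k\<close>, too late to fill a gap of \<open>L + L\<close> below \<open>9 * j\<close> or
  of \<open>L + U\<close> below \<open>9 * k\<close>.\<close>

definition lower_fringe :: "nat \<Rightarrow> nat \<Rightarrow> int set" where
  "lower_fringe j k = {x. 0 \<le> x \<and> (x mod 9 \<in> {0,1,2,5} \<or>
     9 * int j \<le> x \<and> x mod 9 = 8 \<or> 9 * int (j + k) \<le> x)}"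

definition upper_fringe :: "nat \<Rightarrow> int set" where
  "upper_fringe k = {x. 0 \<le> x \<and> (x mod 9 \<in> {0,1,3,4} \<or> 9 * int k \<le> x)}"

lemma fringes_lower_upper: "fringes (lower_fringe j k) (upper_fringe k) (9 * (j + k))"
  by unfold_locales (auto simp: lower_fringe_def upper_fringe_def)

lemma mod_9_cases:
  fixes x :: int
  obtains "x mod 9 = 0" | "x mod 9 = 1" | "x mod 9 = 2" | "x mod 9 = 3" | "x mod 9 = 4"
    | "x mod 9 = 5" | "x mod 9 = 6" | "x mod 9 = 7" | "x mod 9 = 8"
  by atomize_elim presburger

lemma lower_fringe_residue: "0 \<le> x \<Longrightarrow> x mod 9 \<in> {0,1,2,5} \<Longrightarrow> x \<in> lower_fringe j k"
  unfolding lower_fringe_def by blast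

lemma upper_fringe_residue: "0 \<le> x \<Longrightarrow> x mod 9 \<in> {0,1,3,4} \<Longrightarrow> x \<in> upper_fringe k"
  unfolding upper_fringe_def by blast

text \<open>As \<open>a + b\<close> equals the residue \<open>r\<close> without carry,
  \<open>x - a\<close> is nonnegative of residue \<open>b\<close>. One fixed element
  \<open>a\<close> and one full class then suffice, and membership becomes a table lookup.\<close>

lemma mem_plus_by_residue:
  fixes S T :: "int set"
  assumes "0 \<le> x" "x mod 9 = r" "a + b = r" "0 \<le> a" "0 \<le> b" "a \<in> S"
    and "\<And>y. 0 \<le> y \<Longrightarrow> y mod 9 = b \<Longrightarrow> y \<in> T"
  shows "x \<in> S + T"
proof -
  have "a + b \<le> x" using zmod_le_nonneg_dividend[OF assms(1), of 9] assms(2,3) by simp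
  moreover have "(x - a) mod 9 = b"
    using assms(2-5) pos_mod_bound[of 9 x] mod_diff_left_eq[of x 9 a] by simp
  ultimately have "a + (x - a) \<in> S + T"
    using assms(5-7) by (intro set_plus_intro) auto
  then show ?thesis by simp
qed

text \<open>Summands of some \<open>x < 9 * j\<close> are themselves below \<open>9 * j\<close>,
  hence have residues in \<open>{0,1,2,5}\<close>, no two of which add up to 8 modulo 9.\<close>

lemma mem_lower_plus_lower:
  "x \<in> lower_fringe j k + lower_fringe j k \<longleftrightarrow> 0 \<le> x \<and> \<not> (x < 9 * int j \<and> x mod 9 = 8)"
    (is "?P \<longleftrightarrow> ?Q")
proof
  assume ?P
  then obtain a b where ab: "x = a + b" "a \<in> lower_fringe j k" "b \<in> lower_fringe j k"
    by (auto elim: set_plus_elim)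
  have False if "x < 9 * int j" "x mod 9 = 8"
  proof -
    have "a mod 9 \<in> {0,1,2,5}" "b mod 9 \<in> {0,1,2,5}"
      using ab that by (auto simp: lower_fringe_def)
    then show False using that(2) mod_add_eq[of a 9 b] ab(1) by auto
  qed
  then show ?Q using ab by (auto simp: lower_fringe_def)
next
  assume Q: ?Q
  note * = mem_plus_by_residue[where x = x]
  show ?P
  proof (cases x rule: mod_9_cases)
    case 1 with Q show ?thesis by (intro *[where a=0 and b=0]) (auto intro: lower_fringe_residue)
  next
    case 2 with Q show ?thesis by (intro *[where a=0 and b=1]) (auto intro: lower_fringe_residue)
  next
    case 3 with Q show ?thesis by (intro *[where a=0 and b=2]) (auto intro: lower_fringe_residue)
  next
    case 4 with Q show ?thesis by (intro *[where a=1 and b=2]) (auto intro: lower_fringe_residue)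
  next
    case 5 with Q show ?thesis by (intro *[where a=2 and b=2]) (auto intro: lower_fringe_residue)
  next
    case 6 with Q show ?thesis by (intro *[where a=0 and b=5]) (auto intro: lower_fringe_residue)
  next
    case 7 with Q show ?thesis by (intro *[where a=1 and b=5]) (auto intro: lower_fringe_residue)
  next
    case 8 with Q show ?thesis by (intro *[where a=2 and b=5]) (auto intro: lower_fringe_residue)
  next
    \<comment> \<open>No table entry yields 8, but here \<open>x\<close> is at least
      \<open>9 * j\<close>, so \<open>x\<close> itself is in the lower fringe and
      \<open>0 + x\<close> works.\<close>
    case 9
    with Q have "0 \<in> lower_fringe j k" "x \<in> lower_fringe j k" by (auto simp: lower_fringe_def)
    then show ?thesis using set_plus_intro by fastforce
  qed
qed

lemma mem_upper_plus_upper: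
  "x \<in> upper_fringe k + upper_fringe k \<longleftrightarrow> 0 \<le> x" (is "?P \<longleftrightarrow> ?Q")
proof
  assume ?P
  then show ?Q by (auto elim!: set_plus_elim simp: upper_fringe_def)
next
  assume Q: ?Q
  note * = mem_plus_by_residue[where x = x]
  show ?P
  proof (cases x rule: mod_9_cases)
    case 1 with Q show ?thesis by (intro *[where a=0 and b=0]) (auto intro: upper_fringe_residue)
  next
    case 2 with Q show ?thesis by (intro *[where a=0 and b=1]) (auto intro: upper_fringe_residue)
  next
    case 3 with Q show ?thesis by (intro *[where a=1 and b=1]) (auto intro: upper_fringe_residue)
  next
    case 4 with Q show ?thesis by (intro *[where a=0 and b=3]) (auto intro: upper_fringe_residue)
  next
    case 5 with Q show ?thesis by (intro *[where a=0 and b=4]) (auto intro: upper_fringe_residue)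
  next
    case 6 with Q show ?thesis by (intro *[where a=1 and b=4]) (auto intro: upper_fringe_residue)
  next
    case 7 with Q show ?thesis by (intro *[where a=3 and b=3]) (auto intro: upper_fringe_residue)
  next
    case 8 with Q show ?thesis by (intro *[where a=3 and b=4]) (auto intro: upper_fringe_residue)
  next
    case 9 with Q show ?thesis by (intro *[where a=4 and b=4]) (auto intro: upper_fringe_residue)
  qed
qed

text \<open>The extra class 8 is harmless: added to \<open>{0,1,3,4}\<close> it gives 8, 0, 2, 3
  modulo 9, never 7.\<close>

lemma mem_lower_plus_upper:
  "x \<in> lower_fringe j k + upper_fringe k \<longleftrightarrow> 0 \<le> x \<and> \<not> (x < 9 * int k \<and> x mod 9 = 7)"
    (is "?P \<longleftrightarrow> ?Q")
proof
  assume ?P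
  then obtain a b where ab: "x = a + b" "a \<in> lower_fringe j k" "b \<in> upper_fringe k"
    by (auto elim: set_plus_elim)
  have False if "x < 9 * int k" "x mod 9 = 7"
  proof -
    have "a mod 9 \<in> {0,1,2,5,8}" "b mod 9 \<in> {0,1,3,4}"
      using ab that by (auto simp: lower_fringe_def upper_fringe_def)
    then show False using that(2) mod_add_eq[of a 9 b] ab(1) by auto
  qed
  then show ?Q using ab by (auto simp: lower_fringe_def upper_fringe_def)
next
  assume Q: ?Q
  note * = mem_plus_by_residue[where x = x]
  note residue = lower_fringe_residue upper_fringe_residue
  show ?P
  proof (cases x rule: mod_9_cases)
    case 1 with Q show ?thesis by (intro *[where a=0 and b=0]) (auto intro: residue)
  next
    case 2 with Q show ?thesis by (intro *[where a=0 and b=1]) (auto intro: residue)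
  next
    case 3 with Q show ?thesis by (intro *[where a=1 and b=1]) (auto intro: residue)
  next
    case 4 with Q show ?thesis by (intro *[where a=0 and b=3]) (auto intro: residue)
  next
    case 5 with Q show ?thesis by (intro *[where a=0 and b=4]) (auto intro: residue)
  next
    case 6 with Q show ?thesis by (intro *[where a=5 and b=0]) (auto intro: residue)
  next
    case 7 with Q show ?thesis by (intro *[where a=2 and b=4]) (auto intro: residue)
  next
    \<comment> \<open>Now \<open>x\<close> is at least \<open>9 * k\<close>, where the upper fringe
      is full, so \<open>0 + x\<close> works.\<close>
    case 8
    with Q have "0 \<in> lower_fringe j k" "x \<in> upper_fringe k"
      by (auto simp: lower_fringe_def upper_fringe_def)
    then show ?thesis using set_plus_intro by fastforce
  next
    case 9 with Q show ?thesis by (intro *[where a=5 and b=3]) (auto intro: residue)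
  qed
qed

lemma card_residue_class_below:
  assumes "0 \<le> r" "r < 9"
  shows "card {x::int. 0 \<le> x \<and> x < 9 * int m \<and> x mod 9 = r} = m"
proof -
  have "{x::int. 0 \<le> x \<and> x < 9 * int m \<and> x mod 9 = r} = (\<lambda>i. 9 * int i + r) ` {..<m}"
  proof (intro equalityI subsetI)
    fix x assume x: "x \<in> {x::int. 0 \<le> x \<and> x < 9 * int m \<and> x mod 9 = r}"
    then have "x = 9 * int (nat (x div 9)) + r" "nat (x div 9) < m" by auto
    then show "x \<in> (\<lambda>i. 9 * int i + r) ` {..<m}" by blast
  qed (use assms in auto)
  then show ?thesis by (simp add: card_image inj_on_def)
qed

lemma card_gaps:
  "card (gaps (lower_fringe j k + lower_fringe j k)) = j"
  "card (gaps (upper_fringe k + upper_fringe k)) = 0"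
  "card (gaps (lower_fringe j k + upper_fringe k)) = k"
proof -
  have "gaps (lower_fringe j k + lower_fringe j k) = {x. 0 \<le> x \<and> x < 9 * int j \<and> x mod 9 = 8}"
    by (auto simp: gaps_def mem_lower_plus_lower)
  then show "card (gaps (lower_fringe j k + lower_fringe j k)) = j"
    by (simp add: card_residue_class_below)
  have "gaps (upper_fringe k + upper_fringe k) = {}"
    by (auto simp: gaps_def mem_upper_plus_upper)
  then show "card (gaps (upper_fringe k + upper_fringe k)) = 0" by simp
  have "gaps (lower_fringe j k + upper_fringe k) = {x. 0 \<le> x \<and> x < 9 * int k \<and> x mod 9 = 7}"
    by (auto simp: gaps_def mem_lower_plus_upper)
  then show "card (gaps (lower_fringe j k + upper_fringe k)) = k"
    by (simp add: card_residue_class_below)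
qed

theorem theorem8:
  fixes j k :: nat
  shows "\<exists>c::real. 0 < c \<and> c < 1 \<and>
    (\<forall>\<^sub>F n::nat in sequentially.
      c * 2 ^ (n + 1) \<le> real (card {A :: int set. A \<subseteq> {0..int n} \<and>
        int (card (A + A)) = (2 * int n + 1) - int j \<and>
        int (card (diffset A A)) = (2 * int n + 1) - 2 * int k}))"
  using fringes.positive_proportion[OF fringes_lower_upper[of j k]] by (simp add: card_gaps)

end
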